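(* Let $b\in\mathbb N$, $k,t,\ell\in\mathbb N_+$ with $k\ge3$, $b+\ell\ge3$ and $2\le t\le k-1$; set $n=b(k+1)+\ell k$ and $a=n-1-(b+\ell-1)t$. Then the partitions $g=((k+1)^{[b]},k^{[\ell]})$ and $m=(a,t^{[b+\ell-1]},1)$ satisfy: $g\in\mathcal J(\mathcal L_n)$ is of type A or type B, $m\in\mathcal M(\mathcal L_n)$ is of type IV with $a\ge t+2$, and $g\swarrow m$ holds but $g\nearrow m$ does not hold.
   Context: $\mathbb N=\{0,1,2,\dots\}$, $\mathbb N_+=\mathbb N\setminus\{0\}$. A partition of $n\in\mathbb N$ is a tuple $(a_1,\dots,a_n)$ of natural numbers with $a_1\ge\dots\ge a_n\ge 0$ and $\sum a_i=n$; trailing zeros may be omitted or added. $x^{[s]}$ denotes $s$ consecutive entries equal to $x$ (no entry if $s=0$). $\mathcal L_n$ is the finite lattice of all partitions of $n$ under the dominance order: $a\le b$ iff $\sum_{i=1}^j a_i\le\sum_{i=1}^j b_i$ for all $1\le j\le n$. $\mathcal J(\mathcal L_n)$ is the set of (completely) join-irreducible elements (not the least element, and $x=y\vee z$ implies $x=y$ or $x=z$); $\mathcal M(\mathcal L_n)$ is the set of (completely) meet-irreducible elements (not the greatest element, and $x=y\wedge z$ implies $x=y$ or $x=z$). Arrow relations of the standard context $(\mathcal J(\mathcal L_n),\mathcal M(\mathcal L_n),\le)$: for $g\in\mathcal J(\mathcal L_n)$ and $m\in\mathcal M(\mathcal L_n)$ put $g'=\{y\in\mathcal M(\mathcal L_n):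 g\le y\}$ and $m'=\{y\in\mathcal J(\mathcal L_n): y\le m\}$. Then $g\swarrow m$ iff $g\nleq m$ and for all $h\in\mathcal J(\mathcal L_n)$ with $g'\subsetneq h'$ we have $h\le m$; and $g\nearrow m$ iff $g\nleq m$ and for all $y\in\mathcal M(\mathcal L_n)$ with $m'\subsetneq y'$ we have $g\le y$. Types of partitions of $n$: type A (in $\mathcal J(\mathcal L_n)$): $(k^{[\ell]})$ with $k\ge2$, $\ell\ge 1$; type B (in $\mathcal J(\mathcal L_n)$): $(k^{[b]},(k-1)^{[\ell]})$ with $k\ge2$, $b,\ell\ge1$; type IV (in $\mathcal M(\mathcal L_n)$): $(a,t^{[c]},r)$ with $a>t>r\ge0$ and $t,c\ge2$. *)

theory Defs
  imports "HOL-Algebra.Lattice"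
begin

text \<open>A partition of \<open>n\<close> is represented by the full tuple \<open>(a\<^sub>1, \<dots>, a\<^sub>n)\<close>, that is,
  by a list of length exactly \<open>n\<close> (with its trailing zeros), so that every partition has a unique
  representative. \<open>padded n\<close> adds the trailing zeros that are omitted in the usual notation.\<close>

definition partitions_of :: "nat \<Rightarrow> nat list set" where
  "partitions_of n = {xs. length xs = n \<and> sorted_wrt (\<ge>) xs \<and> sum_list xs = n}"

definition padded :: "nat \<Rightarrow> nat list \<Rightarrow> nat list" where
  "padded n xs = xs @ replicate (n - length xs) 0"

definition dominated :: "nat \<Rightarrow> nat list \<Rightarrow> nat list \<Rightarrow> bool" where
  "dominated n xs ys \<longleftrightarrow> (\<forall>j\<in>{1..n}. sum_list (take j xs) \<le> sum_list (take j ys))"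

definition partition_lattice :: "nat \<Rightarrow> nat list gorder" where
  "partition_lattice n = \<lparr>carrier = partitions_of n, eq = (=), le = dominated n\<rparr>"

text \<open>The following notions are meant for a finite lattice \<open>L\<close>, where irreducible and completely
  irreducible elements coincide. The least and greatest elements, joins and meets are those of
  HOL-Algebra; they are specified by choice and have their intended meaning only where they
  exist.\<close>

definition join_irreducibles :: "('a, 'b) gorder_scheme \<Rightarrow> 'a set" where
  "join_irreducibles L = {x \<in> carrier L. x \<noteq> \<bottom>\<^bsub>L\<^esub> \<and>
     (\<forall>y\<in>carrier L. \<forall>z\<in>carrier L. x = y \<squnion>\<^bsub>L\<^esub> z \<longrightarrow> x = y \<or> x = z)}"

definition meet_irreducibles :: "('a, 'b) gorder_scheme \<Rightarrow> 'a set" where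
  "meet_irreducibles L = {x \<in> carrier L. x \<noteq> \<top>\<^bsub>L\<^esub> \<and>
     (\<forall>y\<in>carrier L. \<forall>z\<in>carrier L. x = y \<sqinter>\<^bsub>L\<^esub> z \<longrightarrow> x = y \<or> x = z)}"

text \<open>The two derivations \<open>g'\<close> (for a join-irreducible \<open>g\<close>) and \<open>m'\<close> (for a meet-irreducible \<open>m\<close>)
  in the standard context of \<open>L\<close> need different names, since an element may be both.\<close>

definition object_deriv :: "('a, 'b) gorder_scheme \<Rightarrow> 'a \<Rightarrow> 'a set" where
  "object_deriv L g = {y \<in> meet_irreducibles L. g \<sqsubseteq>\<^bsub>L\<^esub> y}"

definition attribute_deriv :: "('a, 'b) gorder_scheme \<Rightarrow> 'a \<Rightarrow> 'a set" where
  "attribute_deriv L m = {y \<in> join_irreducibles L. y \<sqsubseteq>\<^bsub>L\<^esub> m}"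

definition down_arrow :: "('a, 'b) gorder_scheme \<Rightarrow> 'a \<Rightarrow> 'a \<Rightarrow> bool" where
  "down_arrow L g m \<longleftrightarrow> \<not> g \<sqsubseteq>\<^bsub>L\<^esub> m \<and>
     (\<forall>h\<in>join_irreducibles L. object_deriv L g \<subset> object_deriv L h \<longrightarrow> h \<sqsubseteq>\<^bsub>L\<^esub> m)"

definition up_arrow :: "('a, 'b) gorder_scheme \<Rightarrow> 'a \<Rightarrow> 'a \<Rightarrow> bool" where
  "up_arrow L g m \<longleftrightarrow> \<not> g \<sqsubseteq>\<^bsub>L\<^esub> m \<and>
     (\<forall>y\<in>meet_irreducibles L. attribute_deriv L m \<subset> attribute_deriv L y \<longrightarrow> g \<sqsubseteq>\<^bsub>L\<^esub> y)"

definition type_A :: "nat \<Rightarrow> nat list \<Rightarrow> bool" where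
  "type_A n xs \<longleftrightarrow> xs \<in> partitions_of n \<and>
     (\<exists>k l. k \<ge> 2 \<and> l \<ge> 1 \<and> xs = padded n (replicate l k))"

definition type_B :: "nat \<Rightarrow> nat list \<Rightarrow> bool" where
  "type_B n xs \<longleftrightarrow> xs \<in> partitions_of n \<and>
     (\<exists>k b l. k \<ge> 2 \<and> b \<ge> 1 \<and> l \<ge> 1 \<and> xs = padded n (replicate b k @ replicate l (k - 1)))"

definition type_IV :: "nat \<Rightarrow> nat list \<Rightarrow> bool" where
  "type_IV n xs \<longleftrightarrow> xs \<in> partitions_of n \<and>
     (\<exists>a t c r. a > t \<and> t > r \<and> t \<ge> 2 \<and> c \<ge> 2 \<and> xs = padded n (a # replicate c t @ [r]))"

end

theory Submission
  imports Defs "HOL-Algebra.Complete_Lattice"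
begin

text \<open>Let \<open>N = b + l\<close>. The partition \<open>g\<close> is the balanced partition with \<open>N\<close> parts, hence the least
  partition with at most \<open>N\<close> nonzero parts: \<open>g \<le> y\<close> iff the first \<open>N\<close> parts of \<open>y\<close> sum to \<open>n\<close>.
  Everything strictly below \<open>g\<close> therefore has an \<open>N\<close>-th partial sum of at most \<open>n - 1\<close> and,
  since \<open>t < k\<close>, lies below \<open>m\<close>, while \<open>g\<close> does not. This one fact yields both the
  join-irreducibility of \<open>g\<close> and the down-arrow.
  The unique upper cover \<open>(a, t + 1, t, \<dots>, t, t - 1, 1)\<close> of \<open>m\<close> still has more than \<open>N\<close> parts, so
  it is not above \<open>g\<close>, and a meet-irreducible element separating the two refutes the up-arrow.\<close>

section \<open>Irreducible elements of finite complete lattices\<close>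

text \<open>Reversing the order yields the results on join-irreducible elements from those on
  meet-irreducible ones.\<close>

lemma complete_lattice_inv_gorder:
  assumes "complete_lattice L"
  shows "complete_lattice (inv_gorder L)"
proof -
  interpret complete_lattice L by fact
  interpret dual: partial_order "inv_gorder L"
    by (simp add: dual_order_iff partial_order_axioms)
  show ?thesis
    by standard (simp_all add: sup_exists inf_exists)
qed

lemma join_irreducibles_eq_dual: "join_irreducibles L = meet_irreducibles (inv_gorder L)"
  by (simp add: join_irreducibles_def meet_irreducibles_def)

text \<open>If \<open>x\<close> were the meet of two elements other than \<open>x\<close>, both
  would lie above \<open>x\<close>, hence above \<open>u\<close>, and so would their meet
  \<open>x\<close>. Later \<open>u\<close> is the upper cover of \<open>m\<close>.\<close>

lemma meet_irreducibleI:
  assumes "complete_lattice L" and x: "x \<in> carrier L" and u: "u \<in> carrier L"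
    and "\<not> u \<sqsubseteq>\<^bsub>L\<^esub> x"
    and above: "\<And>y. y \<in> carrier L \<Longrightarrow> x \<sqsubseteq>\<^bsub>L\<^esub> y \<Longrightarrow> y \<noteq> x \<Longrightarrow> u \<sqsubseteq>\<^bsub>L\<^esub> y"
  shows "x \<in> meet_irreducibles L"
proof -
  interpret complete_lattice L by fact
  have "x \<noteq> \<top>\<^bsub>L\<^esub>"
    using assms top_higher by blast
  moreover have "x = y \<or> x = z" if "y \<in> carrier L" "z \<in> carrier L" "x = y \<sqinter>\<^bsub>L\<^esub> z" for y z
    using that above[of y] above[of z] meet_left[of y z] meet_right[of y z] meet_le[of u y z] u
      \<open>\<not> u \<sqsubseteq>\<^bsub>L\<^esub> x\<close> by metis
  ultimately show ?thesis
    using x by (auto simp: meet_irreducibles_def)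
qed

text \<open>The dual criterion: \<open>u\<close> only has to bound what lies strictly below
  \<open>x\<close> without being above \<open>x\<close> itself. For \<open>g\<close> this bound is
  \<open>m\<close>.\<close>

lemma join_irreducibleI:
  assumes "complete_lattice L" and "x \<in> carrier L" and "u \<in> carrier L"
    and "\<not> x \<sqsubseteq>\<^bsub>L\<^esub> u"
    and "\<And>y. y \<in> carrier L \<Longrightarrow> y \<sqsubseteq>\<^bsub>L\<^esub> x \<Longrightarrow> y \<noteq> x \<Longrightarrow> y \<sqsubseteq>\<^bsub>L\<^esub> u"
  shows "x \<in> join_irreducibles L"
  unfolding join_irreducibles_eq_dual
  by (rule meet_irreducibleI[OF complete_lattice_inv_gorder, where u = u]) (use assms in auto)

text \<open>A maximal element among those above \<open>y\<close> but not above \<open>x\<close>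
  works: everything strictly above it is above \<open>x\<close>, so \<open>meet_irreducibleI\<close>
  applies with \<open>u = x\<close>.\<close>

lemma ex_meet_irreducible_separating:
  assumes "complete_lattice L" and fin: "finite (carrier L)"
    and x: "x \<in> carrier L" and y: "y \<in> carrier L" and "\<not> x \<sqsubseteq>\<^bsub>L\<^esub> y"
  obtains m where "m \<in> meet_irreducibles L" and "y \<sqsubseteq>\<^bsub>L\<^esub> m" and "\<not> x \<sqsubseteq>\<^bsub>L\<^esub> m"
proof -
  interpret complete_lattice L by fact
  define A where "A = {z \<in> carrier L. y \<sqsubseteq>\<^bsub>L\<^esub> z \<and> \<not> x \<sqsubseteq>\<^bsub>L\<^esub> z}"
  define up where "up z = {w \<in> carrier L. z \<sqsubseteq>\<^bsub>L\<^esub> w}" for z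
  have "y \<in> A"
    using assms by (simp add: A_def)
  \<comment> \<open>By finiteness, an element of \<open>A\<close> with the smallest up-set is
    maximal in \<open>A\<close>.\<close>
  then obtain m where m: "m \<in> A" and min: "\<And>z. z \<in> A \<Longrightarrow> card (up m) \<le> card (up z)"
    using ex_has_least_nat[of "\<lambda>z. z \<in> A" y "\<lambda>z. card (up z)"] by blast
  have mc: "m \<in> carrier L" and ym: "y \<sqsubseteq>\<^bsub>L\<^esub> m" and xm: "\<not> x \<sqsubseteq>\<^bsub>L\<^esub> m"
    using m by (auto simp: A_def)
  have above: "x \<sqsubseteq>\<^bsub>L\<^esub> z" if z: "z \<in> carrier L" "m \<sqsubseteq>\<^bsub>L\<^esub> z" "z \<noteq> m" for z
  proof (rule ccontr)
    assume "\<not> x \<sqsubseteq>\<^bsub>L\<^esub> z"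
    then have "z \<in> A"
      using z le_trans[OF ym] y mc by (auto simp: A_def)
    moreover have "up z \<subset> up m"
    proof
      show "up z \<subseteq> up m"
        using le_trans[OF z(2)] z mc by (auto simp: up_def)
      have "m \<in> up m" "m \<notin> up z"
        using mc z le_antisym by (auto simp: up_def)
      then show "up z \<noteq> up m" by blast
    qed
    moreover have "finite (up m)"
      using fin by (simp add: up_def)
    ultimately show False
      using min[of z] psubset_card_mono[of "up m" "up z"] by simp
  qed
  have "m \<in> meet_irreducibles L"
    by (rule meet_irreducibleI[OF \<open>complete_lattice L\<close> mc x xm above])
  then show thesis
    using that ym xm by blast
qed

lemma ex_join_irreducible_separating:
  assumes "complete_lattice L" and "finite (carrier L)"
    and "x \<in> carrier L" and "y \<in> carrier L" and "\<not> x \<sqsubseteq>\<^bsub>L\<^esub> y"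
  obtains j where "j \<in> join_irreducibles L" and "j \<sqsubseteq>\<^bsub>L\<^esub> x" and "\<not> j \<sqsubseteq>\<^bsub>L\<^esub> y"
  using ex_meet_irreducible_separating[OF complete_lattice_inv_gorder, of L y x] assms
  by (auto simp: join_irreducibles_eq_dual)

text \<open>Meet-irreducible elements separate, so inclusion of derivations gives \<open>h\<close>
  below \<open>g\<close>; properness of the inclusion excludes \<open>h = g\<close>.\<close>

lemma down_arrowI:
  assumes "complete_lattice L" and "finite (carrier L)"
    and g: "g \<in> carrier L" and "\<not> g \<sqsubseteq>\<^bsub>L\<^esub> m"
    and below: "\<And>h. h \<in> carrier L \<Longrightarrow> h \<sqsubseteq>\<^bsub>L\<^esub> g \<Longrightarrow> h \<noteq> g \<Longrightarrow> h \<sqsubseteq>\<^bsub>L\<^esub> m"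
  shows "down_arrow L g m"
proof -
  have "h \<sqsubseteq>\<^bsub>L\<^esub> m" if h: "h \<in> join_irreducibles L" "object_deriv L g \<subset> object_deriv L h" for h
  proof -
    have hc: "h \<in> carrier L"
      using h by (simp add: join_irreducibles_def)
    have "h \<sqsubseteq>\<^bsub>L\<^esub> g"
      using ex_meet_irreducible_separating[OF assms(1,2) hc g] h(2)
      by (auto simp: object_deriv_def)
    then show ?thesis
      using below[OF hc] h by blast
  qed
  then show ?thesis
    using assms(4) by (auto simp: down_arrow_def)
qed

text \<open>A meet-irreducible \<open>y\<close> above \<open>u\<close> but not above
  \<open>g\<close> is the counterexample. Its derivation properly contains that of \<open>m\<close>,
  because some join-irreducible element lies below \<open>u\<close> but not below
  \<open>m\<close>.\<close>

lemma not_up_arrowI: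
  assumes "complete_lattice L" and "finite (carrier L)"
    and g: "g \<in> carrier L" and m: "m \<in> carrier L" and u: "u \<in> carrier L"
    and "m \<sqsubseteq>\<^bsub>L\<^esub> u" and "\<not> u \<sqsubseteq>\<^bsub>L\<^esub> m" and "\<not> g \<sqsubseteq>\<^bsub>L\<^esub> u"
  shows "\<not> up_arrow L g m"
proof -
  interpret complete_lattice L by fact
  obtain y where y: "y \<in> meet_irreducibles L" "u \<sqsubseteq>\<^bsub>L\<^esub> y" "\<not> g \<sqsubseteq>\<^bsub>L\<^esub> y"
    using ex_meet_irreducible_separating[OF assms(1,2) g u] assms by blast
  have yc: "y \<in> carrier L"
    using y by (simp add: meet_irreducibles_def)
  obtain j where j: "j \<in> join_irreducibles L" "j \<sqsubseteq>\<^bsub>L\<^esub> u" "\<not> j \<sqsubseteq>\<^bsub>L\<^esub> m"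
    using ex_join_irreducible_separating[OF assms(1,2) u m] assms by blast
  have "attribute_deriv L m \<subseteq> attribute_deriv L y"
    using le_trans[OF _ le_trans[OF \<open>m \<sqsubseteq>\<^bsub>L\<^esub> u\<close> y(2)]] m u yc
    by (auto simp: attribute_deriv_def join_irreducibles_def)
  moreover have "j \<in> attribute_deriv L y" "j \<notin> attribute_deriv L m"
    using j le_trans[OF j(2) y(2)] u yc by (auto simp: attribute_deriv_def join_irreducibles_def)
  ultimately have "attribute_deriv L m \<subset> attribute_deriv L y" by blast
  then show ?thesis
    using y by (auto simp: up_arrow_def)
qed

section \<open>Partial sums of partitions\<close>

text \<open>For partial sums this says that the parts decrease. The additive form avoids truncated
  subtraction.\<close>

definition concave_seq :: "(nat \<Rightarrow> nat) \<Rightarrow> bool" where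
  "concave_seq F \<longleftrightarrow> (\<forall>j. F j + F (Suc (Suc j)) \<le> 2 * F (Suc j))"

lemma concave_seqD: "concave_seq F \<Longrightarrow> F j + F (Suc (Suc j)) \<le> 2 * F (Suc j)"
  by (simp add: concave_seq_def)

text \<open>Increments of a concave sequence decrease, so a bound on one increment bounds all later
  ones; the induction carries that bound along.\<close>

lemma concave_seq_upper_bound:
  assumes F: "concave_seq F" and "F (Suc j) \<le> F j + c"
  shows "F (j + d) \<le> F j + d * c"
proof -
  have "F (j + d) \<le> F j + d * c \<and> F (Suc (j + d)) \<le> F (j + d) + c"
  proof (induction d)
    case 0
    then show ?case using assms by simp
  next
    case (Suc d)
    then show ?case using concave_seqD[OF F, of "j + d"] by simp
  qed
  then show ?thesis ..
qed

text \<open>Conversely, a lower bound on one increment holds for all earlier ones.\<close>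

lemma concave_seq_lower_bound:
  assumes F: "concave_seq F" and "F (i + d) + c \<le> F (Suc (i + d))"
  shows "F i + d * c \<le> F (i + d)"
  using assms(2)
proof (induction d)
  case 0
  then show ?case by simp
next
  case (Suc d)
  have "F (i + d) + c \<le> F (Suc (i + d))"
    using concave_seqD[OF F, of "i + d"] Suc.prems by simp
  then show ?case using Suc.IH by simp
qed

abbreviation psum :: "nat list \<Rightarrow> nat \<Rightarrow> nat" where
  "psum xs j \<equiv> sum_list (take j xs)"

lemma sorted_wrt_replicate:
  assumes "P x x"
  shows "sorted_wrt P (replicate n x)"
  using assms by (simp add: sorted_wrt_iff_nth_less)

lemma psum_Suc: "j < length xs \<Longrightarrow> psum xs (Suc j) = psum xs j + xs ! j"
  by (simp add: take_Suc_conv_app_nth)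

lemma psum_ge: "xs \<in> partitions_of n \<Longrightarrow> n \<le> j \<Longrightarrow> psum xs j = n"
  by (simp add: partitions_of_def)

lemma psum_le: "xs \<in> partitions_of n \<Longrightarrow> psum xs j \<le> n"
  by (metis (mono_tags, lifting) append_take_drop_id le_add1 mem_Collect_eq partitions_of_def
      sum_list_append)

lemma concave_psum:
  assumes "xs \<in> partitions_of n"
  shows "concave_seq (psum xs)"
  unfolding concave_seq_def
proof
  fix j
  show "psum xs j + psum xs (Suc (Suc j)) \<le> 2 * psum xs (Suc j)"
  proof (cases "Suc j < n")
    case True
    then have "xs ! Suc j \<le> xs ! j"
      using assms by (auto simp: partitions_of_def sorted_wrt_iff_nth_less)
    then show ?thesis
      using True assms psum_Suc[of j xs] psum_Suc[of "Suc j" xs] by (simp add: partitions_of_def)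
  next
    case False
    then show ?thesis
      using psum_ge[OF assms] psum_le[OF assms, of j] by simp
  qed
qed

lemma partition_eqI:
  assumes "xs \<in> partitions_of n" "ys \<in> partitions_of n" "\<And>j. psum xs j = psum ys j"
  shows "xs = ys"
proof (rule nth_equalityI)
  show len: "length xs = length ys"
    using assms by (simp add: partitions_of_def)
  fix i assume "i < length xs"
  then show "xs ! i = ys ! i"
    using psum_Suc[of i xs] psum_Suc[of i ys] assms(3)[of i] assms(3)[of "Suc i"] len by simp
qed

text \<open>The parts are the increments of \<open>F\<close>: \<open>mono\<close> makes their
  subtraction exact, and \<open>concave\<close> makes them decrease. This builds the top element,
  the infima and the upper cover of \<open>m\<close>.\<close>

lemma ex_partition_with_psum:
  assumes "F 0 = 0" and Fn: "F n = n"
    and mono: "\<And>j. j < n \<Longrightarrow> F j \<le> F (Suc j)"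
    and concave: "\<And>j. Suc j < n \<Longrightarrow> F j + F (Suc (Suc j)) \<le> 2 * F (Suc j)"
  obtains xs where "xs \<in> partitions_of n" and "\<And>j. j \<le> n \<Longrightarrow> psum xs j = F j"
proof -
  define xs where "xs = map (\<lambda>j. F (Suc j) - F j) [0..<n]"
  have sums: "psum xs j = F j" if "j \<le> n" for j
    using that
  proof (induction j)
    case (Suc j)
    then show ?case
      using mono[of j] psum_Suc[of j xs] by (simp add: xs_def)
  qed (simp add: \<open>F 0 = 0\<close>)
  have "xs ! Suc j \<le> xs ! j" if "Suc j < n" for j
    using concave[OF that] mono[of j] mono[of "Suc j"] that by (simp add: xs_def)
  then have "sorted_wrt (\<ge>) xs"
    by (subst sorted_wrt_iff_nth_Suc_transp) (auto simp: xs_def intro: transpI)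
  moreover have "length xs = n"
    by (simp add: xs_def)
  ultimately have "xs \<in> partitions_of n"
    using sums[of n] Fn by (simp add: partitions_of_def)
  then show thesis
    using that sums by blast
qed

lemma finite_partitions_of: "finite (partitions_of n)"
proof (rule finite_subset)
  show "partitions_of n \<subseteq> {xs. set xs \<subseteq> {..n} \<and> length xs = n}"
    using member_le_sum_list by (fastforce simp: partitions_of_def)
qed (simp add: finite_lists_length_eq)

section \<open>The dominance order is a complete lattice\<close>

lemma carrier_partition_lattice [simp]: "carrier (partition_lattice n) = partitions_of n"
  by (simp add: partition_lattice_def)

lemma eq_partition_lattice [simp]: "x .=\<^bsub>partition_lattice n\<^esub> y \<longleftrightarrow> x = y"
  by (simp add: partition_lattice_def)

text \<open>Outside \<open>{1..n}\<close> the partial sums of any two partitions agree, being 0 or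
  \<open>n\<close>.\<close>

lemma le_partition_lattice_iff:
  assumes "x \<in> partitions_of n" "y \<in> partitions_of n"
  shows "x \<sqsubseteq>\<^bsub>partition_lattice n\<^esub> y \<longleftrightarrow> (\<forall>j. psum x j \<le> psum y j)"
proof -
  have "psum x j \<le> psum y j" if "j \<notin> {1..n}" for j
  proof (cases "j = 0")
    case False
    then show ?thesis using that psum_ge[OF assms(1)] psum_ge[OF assms(2)] by simp
  qed simp
  then show ?thesis
    by (auto simp: partition_lattice_def dominated_def)
qed

lemma partial_order_partition_lattice: "partial_order (partition_lattice n)"
proof unfold_locales
  fix x y
  assume "x \<sqsubseteq>\<^bsub>partition_lattice n\<^esub> y" "y \<sqsubseteq>\<^bsub>partition_lattice n\<^esub> x"
    and "x \<in> carrier (partition_lattice n)" "y \<in> carrier (partition_lattice n)"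
  then show "x .=\<^bsub>partition_lattice n\<^esub> y"
    by (auto simp: le_partition_lattice_iff intro!: partition_eqI order_antisym)
next
  fix x y z
  assume "x \<sqsubseteq>\<^bsub>partition_lattice n\<^esub> y" "y \<sqsubseteq>\<^bsub>partition_lattice n\<^esub> z"
    and "x \<in> carrier (partition_lattice n)" "y \<in> carrier (partition_lattice n)"
      "z \<in> carrier (partition_lattice n)"
  then show "x \<sqsubseteq>\<^bsub>partition_lattice n\<^esub> z"
    by (auto simp: le_partition_lattice_iff intro: order_trans)
qed (auto simp: le_partition_lattice_iff fun_eq_iff)

text \<open>A pointwise minimum of concave sequences is concave, so infima are computed on partial
  sums. With a greatest element, here the one-part partition, this suffices.\<close>

lemma complete_lattice_partition_lattice: "complete_lattice (partition_lattice n)"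
proof -
  interpret partial_order "partition_lattice n"
    by (rule partial_order_partition_lattice)
  show ?thesis
  proof (rule complete_lattice_criterion1)
    obtain x where x: "x \<in> partitions_of n" "\<And>j. j \<le> n \<Longrightarrow> psum x j = (if j = 0 then 0 else n)"
      by (rule ex_partition_with_psum[of "\<lambda>j. if j = 0 then 0 else n" n]) auto
    have "psum y j \<le> psum x j" if "y \<in> partitions_of n" for y j
      using x(2)[of j] psum_le[OF that, of j] psum_ge[OF x(1), of j] by (cases "j \<le> n") auto
    then show "\<exists>x. greatest (partition_lattice n) x (carrier (partition_lattice n))"
      using x by (auto simp: greatest_def le_partition_lattice_iff intro!: exI[of _ x])
  next
    fix A assume A: "A \<subseteq> carrier (partition_lattice n)" "A \<noteq> {}"
    define F where "F j = (INF x\<in>A. psum x j)" for j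
    have F_le: "F j \<le> psum x j" if "x \<in> A" for x j
      using that by (auto simp: F_def intro: cINF_lower)
    have F_attained: "\<exists>x\<in>A. F j = psum x j" for j
      using Inf_nat_def1[of "(\<lambda>x. psum x j) ` A"] A by (auto simp: F_def)
    have P: "x \<in> partitions_of n" if "x \<in> A" for x
      using A that by auto
    obtain i where i: "i \<in> partitions_of n" "\<And>j. j \<le> n \<Longrightarrow> psum i j = F j"
    proof (rule ex_partition_with_psum[of F n])
      show "F 0 = 0" using F_attained[of 0] by simp
      show "F n = n" using F_attained[of n] psum_ge P by auto
      fix j
      show "F j \<le> F (Suc j)" if "j < n"
      proof -
        obtain x where x: "x \<in> A" "F (Suc j) = psum x (Suc j)"
          using F_attained by blast
        have "psum x j \<le> psum x (Suc j)"
          using psum_Suc[of j x] P[OF x(1)] that by (simp add: partitions_of_def)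
        then show ?thesis using F_le[OF x(1), of j] x(2) by simp
      qed
      \<comment> \<open>The minimum at the middle index is attained by some \<open>x\<close>, whose
        outer sums bound those of \<open>F\<close> from above.\<close>
      obtain x where x: "x \<in> A" "F (Suc j) = psum x (Suc j)"
        using F_attained by blast
      then show "F j + F (Suc (Suc j)) \<le> 2 * F (Suc j)"
        using concave_seqD[OF concave_psum[OF P[OF x(1)]], of j] F_le[OF x(1), of j]
          F_le[OF x(1), of "Suc (Suc j)"] by simp
    qed blast
    have "psum i j \<le> psum x j" if "x \<in> A" for x j
      using i(2)[of j] F_le[OF that, of j] psum_ge[OF i(1), of j] psum_ge[OF P[OF that], of j]
      by (cases "j \<le> n") auto
    moreover have "psum y j \<le> psum i j"
      if y: "y \<in> partitions_of n" "\<And>x j. x \<in> A \<Longrightarrow> psum y j \<le> psum x j" for y j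
      using i(2)[of j] F_attained[of j] y(2)[of _ j] psum_ge[OF i(1), of j] psum_le[OF y(1), of j]
      by (cases "j \<le> n") auto
    ultimately have "greatest (partition_lattice n) i (Lower (partition_lattice n) A)"
      using A i(1) P by (intro greatest_LowerI) (auto simp: Lower_def le_partition_lattice_iff)
    then show "\<exists>i. greatest (partition_lattice n) i (Lower (partition_lattice n) A)" ..
  qed
qed

section \<open>Partitions of types A, B and IV\<close>

text \<open>The numbers \<open>j * k + min j b\<close> are the partial sums of the balanced partition of \<open>N * k + b\<close>
  into \<open>N\<close> parts.\<close>

lemma balanced_le_psum:
  assumes y: "y \<in> partitions_of n" and full: "psum y N = n"
    and n: "n = N * k + b" and "b \<le> N" and "j \<le> N"
  shows "j * k + min j b \<le> psum y j"
proof (rule ccontr)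
  assume less: "\<not> j * k + min j b \<le> psum y j"
  note conc = concave_psum[OF y]
  \<comment> \<open>Otherwise the first \<open>j\<close> parts would all be at least
    \<open>k + 1\<close>, too much for the assumed small sum.\<close>
  have "psum y (Suc j) \<le> psum y j + k"
  proof (rule ccontr)
    assume "\<not> psum y (Suc j) \<le> psum y j + k"
    then have "j * Suc k \<le> psum y j"
      using concave_seq_lower_bound[OF conc, of 0 j "Suc k"] by simp
    then show False
      using less by simp
  qed
  \<comment> \<open>The remaining \<open>N - j\<close> parts are at most \<open>k\<close> each, yet
    must complete the sum to \<open>n\<close>.\<close>
  then have "n \<le> psum y j + (N - j) * k"
    using concave_seq_upper_bound[OF conc, of j k "N - j"] full \<open>j \<le> N\<close> by simp
  moreover have "(N - j) * k + j * k = N * k"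
    using \<open>j \<le> N\<close> by (metis add_mult_distrib le_add_diff_inverse2)
  ultimately show False
    using less n by simp
qed

text \<open>A concave sequence lying above a line and touching it at an interior point coincides
  with it. The range of \<open>j\<close> keeps both neighbours on the linear stretch
  \<open>1..N\<close>.\<close>

lemma above_type_IV_strict:
  assumes y: "y \<in> partitions_of n" and z: "z \<in> partitions_of n"
    and le: "\<And>j. psum z j \<le> psum y j" and "y \<noteq> z"
    and lin: "\<And>j. j < N \<Longrightarrow> psum z (Suc j) = a + j * t"
    and full: "\<And>j. N < j \<Longrightarrow> psum z j = n"
    and j: "2 \<le> j" "j < N"
  shows "psum z j < psum y j"
proof (rule ccontr)
  assume "\<not> psum z j < psum y j"
  then have eq: "psum y j = psum z j"
    using le[of j] by simp
  note conc = concave_psum[OF y]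
  obtain i where i: "j = Suc (Suc i)"
    using j by (metis Suc_le_D numeral_2_eq_2 Suc_le_mono)
  have at: "psum y (Suc (Suc i)) = a + Suc i * t" "a + i * t \<le> psum y (Suc i)"
    "a + Suc (Suc i) * t \<le> psum y (Suc (Suc (Suc i)))"
    using eq le[of "Suc i"] le[of "Suc (Suc (Suc i))"] lin[of i] lin[of "Suc i"]
      lin[of "Suc (Suc i)"] i j by auto
  have "psum y r \<le> psum z r" for r
  proof -
    consider "r = 0" | "0 < r" "r \<le> Suc i" | "Suc i < r" "r \<le> N" | "N < r" by linarith
    then show ?thesis
    proof cases
      case 2
      then obtain q where q: "r = Suc q" "q \<le> i" by (cases r) auto
      then obtain d where d: "i = q + d" using le_Suc_ex by blast
      have "psum y (Suc q) + Suc d * t \<le> psum y (Suc q + Suc d)"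
        using at d by (intro concave_seq_lower_bound[OF conc]) (simp add: algebra_simps)
      then show ?thesis
        using at d q lin[of q] i j by (simp add: algebra_simps)
    next
      case 3
      then obtain d where d: "r = Suc (Suc i) + d" using le_Suc_ex by (metis Suc_leI)
      have "psum y (Suc (Suc (Suc i))) \<le> psum y (Suc (Suc i)) + t"
        using concave_seqD[OF conc, of "Suc i"] at by simp
      then have "psum y (Suc (Suc i) + d) \<le> psum y (Suc (Suc i)) + d * t"
        by (rule concave_seq_upper_bound[OF conc])
      then show ?thesis
        using at d lin[of "Suc i + d"] 3 by (simp add: algebra_simps)
    next
      case 4
      then show ?thesis using full psum_le[OF y] by simp
    qed simp
  qed
  then have "y = z"
    using le by (intro partition_eqI[OF y z] order_antisym)
  then show False using \<open>y \<noteq> z\<close> by simp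
qed

section \<open>The arrow relations between \<open>g\<close> and \<open>m\<close>\<close>

theorem theorem5p2:
  fixes b k t l n a :: nat and g m :: "nat list"
  assumes "k \<ge> 3" and "l \<ge> 1" and "b + l \<ge> 3" and "2 \<le> t" and "t \<le> k - 1"
    and "n = b * (k + 1) + l * k"
    and "a = n - 1 - (b + l - 1) * t"
    and "g = padded n (replicate b (k + 1) @ replicate l k)"
    and "m = padded n (a # replicate (b + l - 1) t @ [1])"
  shows "g \<in> join_irreducibles (partition_lattice n) \<and> (type_A n g \<or> type_B n g) \<and>
    m \<in> meet_irreducibles (partition_lattice n) \<and> type_IV n m \<and> a \<ge> t + 2 \<and>
    down_arrow (partition_lattice n) g m \<and> \<not> up_arrow (partition_lattice n) g m"
proof -
  let ?L = "partition_lattice n"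
  define N where "N = b + l"
  \<comment> \<open>The slacks \<open>p\<close> and \<open>q\<close> replace the inequalities on
    \<open>N\<close> and \<open>k\<close> by equations without subtraction.\<close>
  obtain p where p: "N = p + 3"
    using \<open>b + l \<ge> 3\<close> by (metis N_def add.commute le_Suc_ex)
  have "t + 1 \<le> k"
    using \<open>t \<le> k - 1\<close> \<open>k \<ge> 3\<close> by simp
  then obtain q where q: "k = t + 1 + q"
    using le_Suc_ex by blast
  have n: "n = N * k + b"
    using assms by (simp add: N_def algebra_simps)
  have bN: "b < N"
    using assms by (simp add: N_def)
  \<comment> \<open>The \<open>N + 1\<close> entries of \<open>m\<close> must fit into a list of
    length \<open>n\<close>.\<close>
  have Nn: "N < n"
    using p \<open>k \<ge> 3\<close> mult_le_mono2[of 3 k N] by (simp add: n)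
  \<comment> \<open>Hence the subtraction defining \<open>a\<close> is not truncated.\<close>
  have "(N - 1) * t + 1 \<le> n"
    unfolding n p q by (simp add: algebra_simps)
  then have na: "n = a + (N - 1) * t + 1"
    using \<open>a = _\<close> by (simp add: N_def)
  have a: "t + 2 \<le> a"
    using na n p q by (simp add: algebra_simps)

  have g_list: "g = replicate b (k + 1) @ replicate l k @ replicate (n - N) 0"
    using assms(8) by (simp add: padded_def N_def)
  have m_list: "m = a # replicate (N - 1) t @ 1 # replicate (n - Suc N) 0"
    using assms(9) p by (simp add: padded_def N_def)
  have g_part: "g \<in> partitions_of n"
    using Nn n by (auto simp: g_list partitions_of_def sorted_wrt_append sorted_wrt_replicate
      sum_list_replicate N_def algebra_simps)
  have m_part: "m \<in> partitions_of n"
    using Nn na a p \<open>2 \<le> t\<close> by (auto simp: m_list partitions_of_def sorted_wrt_append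
      sorted_wrt_replicate sum_list_replicate)
  have g_psum: "psum g j = j * k + min j b" if "j \<le> N" for j
    using that by (auto simp: g_list N_def sum_list_replicate min_def algebra_simps
      diff_mult_distrib)
  have m_psum: "psum m (Suc j) = a + j * t" if "j < N" for j
    using that by (auto simp: m_list sum_list_replicate min_def)
  have m_full: "psum m j = n" if "N < j" for j
    using that na p by (cases j) (auto simp: m_list sum_list_replicate min_def take_Cons')

  have "psum g N = n"
    using g_psum[of N] bN n by simp
  moreover have "psum m N = n - 1"
    using m_psum[of "N - 1"] p na by (simp add: numeral_3_eq_3)
  ultimately have g_not_le_m: "\<not> g \<sqsubseteq>\<^bsub>?L\<^esub> m"
    using Nn by (auto simp: le_partition_lattice_iff[OF g_part m_part] intro!: exI[of _ N])

  have below_g: "y \<sqsubseteq>\<^bsub>?L\<^esub> m" if y: "y \<in> partitions_of n" "y \<sqsubseteq>\<^bsub>?L\<^esub> g" "y \<noteq> g" for y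
  proof -
    have yg: "psum y j \<le> psum g j" for j
      using y le_partition_lattice_iff[OF y(1) g_part] by blast
    have yN: "psum y N \<le> n - 1"
    proof (rule ccontr)
      assume "\<not> psum y N \<le> n - 1"
      then have full: "psum y N = n"
        using psum_le[OF y(1), of N] by simp
      have "psum g j \<le> psum y j" for j
      proof (cases "j \<le> N")
        case True
        then show ?thesis
          using balanced_le_psum[OF y(1) full n _ True] bN g_psum by simp
      next
        case False
        have "n \<le> psum y j"
          using full sum_list_append[of "take N y" "take (j - N) (drop N y)"] False
            take_add[of N "j - N" y] by simp
        then show ?thesis
          using psum_le[OF g_part, of j] by simp
      qed
      then have "y = g"
        using yg by (intro partition_eqI[OF y(1) g_part] order_antisym)
      then show False using y by simp
    qed
    have "psum y j \<le> psum m j" for j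
    proof -
      consider "j = 0" | "0 < j" "j < N" | "j = N" | "N < j" by linarith
      then show ?thesis
      proof cases
        case 2
        then obtain i d where i: "j = Suc i" and d: "N = Suc i + Suc d"
          by (metis Suc_pred less_iff_Suc_add add_Suc_right)
        \<comment> \<open>Each of the \<open>Suc d\<close> parts of \<open>g\<close> after position
          \<open>j\<close> exceeds \<open>t\<close> by at least \<open>q + 1\<close>; one unit is
          lost because \<open>m\<close> has sum \<open>n - 1\<close> at \<open>N\<close>.\<close>
        have "psum g j + q * Suc d + d \<le> psum m j"
          using g_psum[of j] m_psum[of i] i 2 n na d q by (simp add: algebra_simps)
        then show ?thesis
          using yg[of j] by simp
      next
        case 3
        then show ?thesis
          using yN \<open>psum m N = n - 1\<close> by simp
      next
        case 4
        then show ?thesis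
          using m_full psum_le[OF y(1)] by simp
      qed simp
    qed
    then show ?thesis
      by (simp add: le_partition_lattice_iff[OF y(1) m_part])
  qed

  \<comment> \<open>Partial sums of the upper cover: those of \<open>m\<close> raised by 1 exactly
    at the positions from 2 to \<open>N - 1\<close>, a nonempty range as \<open>N\<close> is at
    least 3. The bounds on \<open>a\<close> and \<open>t\<close> keep the parts decreasing.\<close>
  define F where "F j = (if j = 0 then 0 else if j \<le> N
    then a + (j - 1) * t + (if 2 \<le> j \<and> j < N then 1 else 0) else n)" for j
  obtain u where u: "u \<in> partitions_of n" "\<And>j. j \<le> n \<Longrightarrow> psum u j = F j"
  proof (rule ex_partition_with_psum[of F n])
    show "F 0 = 0" "F n = n"
      using Nn by (auto simp: F_def)
    fix j
    consider "j = 0" | i where "j = Suc i" "j < N" | i where "j = Suc i" "j = N" | "N < j"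
      by (metis linorder_cases not0_implies_Suc)
    then show "F j \<le> F (Suc j)"
      by cases (use p na \<open>2 \<le> t\<close> in \<open>auto simp: F_def\<close>)
    consider "j = 0" | i where "j = Suc i" "Suc (Suc j) < N" | i where "j = Suc i" "Suc (Suc j) = N"
      | i where "j = Suc i" "Suc j = N" | "N \<le> j"
      by (metis Suc_lessI not_less not0_implies_Suc)
    then show "F j + F (Suc (Suc j)) \<le> 2 * F (Suc j)"
      by cases (use a p na \<open>2 \<le> t\<close> in \<open>auto simp: F_def\<close>)
  qed blast
  have u_psum: "psum u j = psum m j + (if 2 \<le> j \<and> j < N then 1 else 0)" for j
  proof (cases "j \<le> N")
    case True
    then show ?thesis
      using u(2)[of j] m_psum[of "j - 1"] Nn by (cases j) (auto simp: F_def)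
  next
    case False
    then show ?thesis
      using u(2)[of j] Nn m_full psum_ge[OF u(1), of j] by (cases "j \<le> n") (auto simp: F_def)
  qed
  have m_le_u: "m \<sqsubseteq>\<^bsub>?L\<^esub> u"
    using le_partition_lattice_iff[OF m_part u(1)] u_psum by simp
  have u_not_le_m: "\<not> u \<sqsubseteq>\<^bsub>?L\<^esub> m"
    using le_partition_lattice_iff[OF u(1) m_part] u_psum[of 2] p
    by (auto simp: not_le intro!: exI[of _ 2])
  \<comment> \<open>The sum at \<open>N\<close> was not raised: it is still \<open>n - 1\<close>,
    while \<open>g\<close> has already reached \<open>n\<close>.\<close>
  have g_not_le_u: "\<not> g \<sqsubseteq>\<^bsub>?L\<^esub> u"
    using le_partition_lattice_iff[OF g_part u(1)] u_psum[of N] \<open>psum g N = n\<close>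
      \<open>psum m N = n - 1\<close> Nn by (auto simp: not_le intro!: exI[of _ N])
  have above_m: "u \<sqsubseteq>\<^bsub>?L\<^esub> y" if y: "y \<in> partitions_of n" "m \<sqsubseteq>\<^bsub>?L\<^esub> y" "y \<noteq> m" for y
  proof -
    have my: "psum m j \<le> psum y j" for j
      using y le_partition_lattice_iff[OF m_part y(1)] by blast
    \<comment> \<open>A strict inequality of integers leaves room for the 1 by which
      \<open>u\<close> exceeds \<open>m\<close>.\<close>
    have "psum u j \<le> psum y j" for j
      using above_type_IV_strict[OF y(1) m_part my y(3) m_psum m_full] my[of j] u_psum[of j]
      by (auto simp: Suc_le_eq)
    then show ?thesis
      by (simp add: le_partition_lattice_iff[OF u(1) y(1)])
  qed

  note L = complete_lattice_partition_lattice[of n]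
  have fin: "finite (carrier ?L)"
    by (simp add: finite_partitions_of)
  have "g \<in> join_irreducibles ?L"
    by (rule join_irreducibleI[OF L, where u = m])
      (use g_part m_part g_not_le_m below_g in auto)
  moreover have "type_A n g \<or> type_B n g"
  proof (cases "b = 0")
    case True
    then have "type_A n g"
      unfolding type_A_def
      by (intro conjI exI[of _ k] exI[of _ l])
        (use g_part assms(1,2,8) in simp_all)
    then show ?thesis ..
  next
    case False
    then have "type_B n g"
      unfolding type_B_def
      \<comment> \<open>\<open>type_B\<close> names the larger part, which is \<open>k + 1\<close>
        here.\<close>
      by (intro conjI exI[of _ "k + 1"] exI[of _ b] exI[of _ l])
        (use g_part assms(1,2,8) in simp_all)
    then show ?thesis ..
  qed
  moreover have "m \<in> meet_irreducibles ?L"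
    by (rule meet_irreducibleI[OF L, where u = u])
      (use u m_part u_not_le_m above_m in auto)
  moreover have "type_IV n m"
    unfolding type_IV_def
    by (intro conjI exI[of _ a] exI[of _ t] exI[of _ "b + l - 1"] exI[of _ 1])
      (use m_part a assms(3,4,9) in simp_all)
  moreover have "down_arrow ?L g m"
    by (rule down_arrowI[OF L fin]) (use g_part g_not_le_m below_g in auto)
  moreover have "\<not> up_arrow ?L g m"
    by (rule not_up_arrowI[OF L fin, where u = u])
      (use g_part m_part u m_le_u u_not_le_m g_not_le_u in auto)
  ultimately show ?thesis
    using a by blast
qed

end
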